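(* Let $F(x) = f(x) + \mathcal{R}(x)$ with $f(x)=\frac{1}{N}\sum_{i=1}^N f_i(x)$, where $f_i:\mathbb{R}^d\to\mathbb{R}$, $i=1,\dots,N$, are differentiable functions with $L$-Lipschitz continuous gradient ($L>0$) and $\mathcal{R}:\mathbb{R}^d\to\mathbb{R}$ is convex, and suppose that $F$ is bounded below by $F_{inf}\in\mathbb{R}$. Let $\{x^{(k)}\}_{k\in\mathbb{N}}$ be the sequence generated by the FB-LISA method (described in the context) applied to $\operatorname{argmin}_{x\in\mathbb{R}^d}F(x)$. Assume that $\alpha_{max}\le \frac{1}{2L}$ and that, for every $k$, $$\mathbb{E}_k\left[\|\nabla f(x^{(k)})-\nabla f_{\mathcal{N}_k}(x^{(k)})\|^2\right]\le \varepsilon_k,$$ where $\mathbb{E}_k[\cdot]$ denotes the conditional expected value with respect to the $\sigma$-algebra generated by $x^{(0)},\dots,x^{(k)}$ and $\{\varepsilon_k\}_{k\in\mathbb{N}}$ is a positive and summable sequence. Then, almost surely, any limit point of the sequence $\{x^{(k)}\}_{k\in\mathbb{N}}$ is a stationary point for the problem $\operatorname{argmin}_{x\in\mathbb{R}^d}F(x)$.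
   Context: Notation. $\|\cdot\|$ is the Euclidean norm. For $\alpha>0$, $\mathrm{prox}_{\alpha\mathcal{R}}(x)=\operatorname{argmin}_{y\in\mathbb{R}^d}\{\alpha\mathcal{R}(y)+\frac12\|y-x\|^2\}$. For a nonempty $\mathcal{N}\subset\{1,\dots,N\}$, $f_{\mathcal{N}}(x)=\frac{1}{|\mathcal{N}|}\sum_{i\in\mathcal{N}}f_i(x)$. A point $\bar x$ is stationary for $\operatorname{argmin} F$ if $0\in\nabla f(\bar x)+\partial\mathcal{R}(\bar x)$, where $\partial\mathcal{R}$ is the convex subdifferential. The FB-LISA method. Inputs: $x^{(0)}\in\mathbb{R}^d$, an integer $n_{max}>0$ with $n_{max}\le N$, an integer $0<N_0<N$, $\alpha_0>0$, $\beta\in(0,1)$, $C>0$, and the positive summable sequence $\{\varepsilon_k\}_{k\in\mathbb{N}}$. The number $\alpha_{max}>0$ is an upper bound on the initial trial steplengths of the line-search, so $\alpha_0\le\alpha_{max}$. Set $\hat k=0$. For epochs $t=1,2,\dots$ (run indefinitely, producing an infinite sequence): 1. Choose the mini-batch size $N_t=\min\left\{n_{max},\max\left\{\left\lceil \frac{C}{\varepsilon_{\hat k+\lceil N/N_{t-1}\rceil}}\right\rceil,N_0\right\}\right\}$. 2. For $k=\hat k,\dots,\hat k+\lceil N/N_t\rceil-1$: (a) choose a mini-batch $\mathcal{N}_k\subset\{1,\dots,N\}$ of size $N_t$ uniformly at random; (b) compute $f_{\mathcal{N}_k}(x^{(k)})$ and $\nabla f_{\mathcal{N}_k}(x^{(k)})$;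 (c) starting from the trial value $\alpha_k=\alpha_0$, compute $\bar x^{(k)}=\mathrm{prox}_{\alpha_k\mathcal{R}}(x^{(k)}-\alpha_k\nabla f_{\mathcal{N}_k}(x^{(k)}))$ and check the line-search inequality $$f_{\mathcal{N}_k}(\bar x^{(k)})\le f_{\mathcal{N}_k}(x^{(k)})+\nabla f_{\mathcal{N}_k}(x^{(k)})^T(\bar x^{(k)}-x^{(k)})+\frac{1}{2\alpha_k}\|\bar x^{(k)}-x^{(k)}\|^2;$$ if it holds go to (d), otherwise replace $\alpha_k$ by $\beta\alpha_k$ and repeat (c); (d) set $x^{(k+1)}=\bar x^{(k)}$ and reset the next trial value to $\alpha_{k+1}=\alpha_0$. 3. Set $\hat k$ equal to (last value of $k$)$+1$. *)

theory Defs
  imports "HOL-Probability.Probability"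
begin

definition grad :: "('a::euclidean_space \<Rightarrow> real) \<Rightarrow> 'a \<Rightarrow> 'a" where
  "grad f x = (THE g. GDERIV f x :> g)"

definition prox :: "real \<Rightarrow> ('a::euclidean_space \<Rightarrow> real) \<Rightarrow> 'a \<Rightarrow> 'a" where
  "prox \<alpha> R x = arg_min (\<lambda>y. \<alpha> * R y + 1/2 * (norm (y - x))\<^sup>2) (\<lambda>_. True)"

definition subdifferential :: "('a::euclidean_space \<Rightarrow> real) \<Rightarrow> 'a \<Rightarrow> 'a set" where
  "subdifferential R x = {v. \<forall>y. R y \<ge> R x + v \<bullet> (y - x)}"

definition stationary_point ::
  "('a::euclidean_space \<Rightarrow> real) \<Rightarrow> ('a \<Rightarrow> real) \<Rightarrow> 'a \<Rightarrow> bool" where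
  "stationary_point f R x \<longleftrightarrow> 0 \<in> (\<lambda>v. grad f x + v) ` subdifferential R x"

definition batch_mean :: "(nat \<Rightarrow> 'a::euclidean_space \<Rightarrow> real) \<Rightarrow> nat set \<Rightarrow> 'a \<Rightarrow> real" where
  "batch_mean f S x = (1 / real (card S)) * (\<Sum>i\<in>S. f i x)"

text \<open>
  \<open>kh t\<close> is the value of the counter at the beginning of epoch \<open>t \<ge> 1\<close> and \<open>Nt t\<close> the
  mini-batch size of that epoch, so epoch \<open>t\<close> performs the iterations \<open>kh t \<le> k < kh (t + 1)\<close>.
  The value \<open>Nt 0\<close> is the input \<open>N0\<close>; \<open>kh 0\<close> is irrelevant.
\<close>

definition fb_lisa_schedule ::
  "nat \<Rightarrow> nat \<Rightarrow> nat \<Rightarrow> real \<Rightarrow> (nat \<Rightarrow> real) \<Rightarrow> (nat \<Rightarrow> nat) \<Rightarrow> (nat \<Rightarrow> nat) \<Rightarrow> bool" where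
  "fb_lisa_schedule N nmax N0 C \<epsilon> kh Nt \<longleftrightarrow>
     Nt 0 = N0 \<and> kh 1 = 0 \<and>
     (\<forall>t\<ge>1. Nt t = min nmax
          (max (nat \<lceil>C / \<epsilon> (kh t + nat \<lceil>real N / real (Nt (t - 1))\<rceil>)\<rceil>) N0)) \<and>
     (\<forall>t\<ge>1. kh (t + 1) = kh t + nat \<lceil>real N / real (Nt t)\<rceil>)"

definition linesearch_ok ::
  "('a::euclidean_space \<Rightarrow> real) \<Rightarrow> ('a \<Rightarrow> real) \<Rightarrow> 'a \<Rightarrow> real \<Rightarrow> bool" where
  "linesearch_ok \<phi> R x a \<longleftrightarrow>
     (let y = prox a R (x - a *\<^sub>R grad \<phi> x)
      in \<phi> y \<le> \<phi> x + grad \<phi> x \<bullet> (y - x) + 1 / (2 * a) * (norm (y - x))\<^sup>2)"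

text \<open>The first of the trial values \<open>a0\<close>, \<open>\<beta> a0\<close>, \<open>\<beta>\<^sup>2 a0\<close>, ... that is accepted.\<close>

definition backtracking_steplength ::
  "('a::euclidean_space \<Rightarrow> real) \<Rightarrow> ('a \<Rightarrow> real) \<Rightarrow> real \<Rightarrow> real \<Rightarrow> 'a \<Rightarrow> real \<Rightarrow> bool" where
  "backtracking_steplength \<phi> R a0 \<beta> x a \<longleftrightarrow>
     (\<exists>m. a = \<beta> ^ m * a0 \<and> linesearch_ok \<phi> R x a \<and>
          (\<forall>j<m. \<not> linesearch_ok \<phi> R x (\<beta> ^ j * a0)))"

definition fb_lisa_step ::
  "('a::euclidean_space \<Rightarrow> real) \<Rightarrow> ('a \<Rightarrow> real) \<Rightarrow> real \<Rightarrow> real \<Rightarrow> 'a \<Rightarrow> 'a \<Rightarrow> bool" where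
  "fb_lisa_step \<phi> R a0 \<beta> x x' \<longleftrightarrow>
     (\<exists>a. backtracking_steplength \<phi> R a0 \<beta> x a \<and> x' = prox a R (x - a *\<^sub>R grad \<phi> x))"

definition history ::
  "'w measure \<Rightarrow> (nat \<Rightarrow> 'w \<Rightarrow> 'a::euclidean_space) \<Rightarrow> nat \<Rightarrow> 'w measure" where
  "history M X k =
     sigma (space M) (\<Union>i\<in>{..k}. {X i -` A \<inter> space M | A. A \<in> sets borel})"

definition minibatches :: "nat \<Rightarrow> nat \<Rightarrow> nat set set" where
  "minibatches N n = {S. S \<subseteq> {1..N} \<and> card S = n}"

text \<open>
  A mini-batch drawn uniformly at random at a given iteration: it is uniform on the index sets
  of size \<open>n\<close>, and independent of the sigma-algebra \<open>H\<close> of the iterates computed so far.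
\<close>

definition uniform_minibatch ::
  "'w measure \<Rightarrow> 'w measure \<Rightarrow> nat \<Rightarrow> nat \<Rightarrow> ('w \<Rightarrow> nat set) \<Rightarrow> bool" where
  "uniform_minibatch M H N n B \<longleftrightarrow>
     B \<in> M \<rightarrow>\<^sub>M count_space (minibatches N n) \<and>
     distr M (count_space (minibatches N n)) B = uniform_count_measure (minibatches N n) \<and>
     prob_space.indep_set M (sets H)
       (sets (vimage_algebra (space M) B (count_space (minibatches N n))))"

definition fb_lisa_process ::
  "'w measure \<Rightarrow> (nat \<Rightarrow> 'a::euclidean_space \<Rightarrow> real) \<Rightarrow> ('a \<Rightarrow> real) \<Rightarrow> nat \<Rightarrow> nat \<Rightarrow> nat \<Rightarrow>
   real \<Rightarrow> real \<Rightarrow> real \<Rightarrow> (nat \<Rightarrow> real) \<Rightarrow> 'a \<Rightarrow> (nat \<Rightarrow> 'w \<Rightarrow> nat set) \<Rightarrow> (nat \<Rightarrow> 'w \<Rightarrow> 'a) \<Rightarrow> bool"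
where
  "fb_lisa_process M f R N nmax N0 a0 \<beta> C \<epsilon> x0 B X \<longleftrightarrow>
     (\<exists>kh Nt. fb_lisa_schedule N nmax N0 C \<epsilon> kh Nt \<and>
        (\<forall>t\<ge>1. \<forall>k. kh t \<le> k \<and> k < kh (t + 1) \<longrightarrow>
           uniform_minibatch M (history M X k) N (Nt t) (B k))) \<and>
     (\<forall>\<omega>\<in>space M. X 0 \<omega> = x0) \<and>
     (\<forall>k. \<forall>\<omega>\<in>space M.
        fb_lisa_step (batch_mean f (B k \<omega>)) R a0 \<beta> (X k \<omega>) (X (Suc k) \<omega>))"

end

theory Submission
  imports Defs
begin

text \<open>
  Because the first trial steplength satisfies \<open>\<alpha>0 \<le> 1 / (2 * L)\<close>, the line search is
  idle: every mini-batch mean has an \<open>L\<close>-Lipschitz gradient, so by the descent lemma the first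
  trial is accepted (\<open>backtracking_accepts_initial\<close>). The method is therefore the proximal
  gradient method with the constant step \<open>a = \<alpha>0\<close> and the inexact gradients
  \<open>g\<^sub>k\<close> of the mini-batches.

  Write \<open>F = \<phi> + R\<close>, \<open>d\<^sub>k = x\<^sub>k\<^sub>+\<^sub>1 - x\<^sub>k\<close> for
  the displacement and \<open>e\<^sub>k = grad \<phi> (x\<^sub>k) - g\<^sub>k\<close> for the gradient error. The
  descent lemma for \<open>\<phi>\<close>, the subgradient inequality at the proximal point and Young's
  inequality for \<open>e\<^sub>k \<bullet> d\<^sub>k\<close> give, along every single path,
  \<open>F x\<^sub>k\<^sub>+\<^sub>1 + L / 2 * (norm d\<^sub>k)\<^sup>2
    \<le> F x\<^sub>k + a / 2 * (norm e\<^sub>k)\<^sup>2\<close>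
  (\<open>inexact_prox_gradient_decrease\<close>). Wherever the squared errors are summable, telescoping and the lower bound on
  \<open>F\<close> make the squared displacements summable, so both \<open>d\<^sub>k\<close> and \<open>e\<^sub>k\<close>
  tend to \<open>0\<close>. The optimality condition of the proximal step puts
  \<open>e\<^sub>k - grad \<phi> (x\<^sub>k) - d\<^sub>k / a\<close> into the subdifferential of \<open>R\<close> at
  \<open>x\<^sub>k\<^sub>+\<^sub>1\<close>, and passing to the limit along a convergent subsequence leaves
  \<open>- grad \<phi> z\<close> in the subdifferential at \<open>z\<close>
  (\<open>inexact_prox_gradient_limit_stationary\<close>).

  Probability enters only through the summability of the squared errors. Their expectations are at
  most \<open>\<epsilon> k\<close>, hence summable, and monotone convergence yields almost sure summability
  (\<open>AE_summable_of_summable_expectation\<close>). To pass from the bound on conditional expectations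
  to one on expectations, the errors have to be measurable and integrable; both hold because the
  start is deterministic and each mini-batch has finitely many values, which makes every iterate a
  simple function (\<open>simple_function_recursion\<close>).
\<close>

section \<open>Gradients and smooth functions\<close>

lemma GDERIV_grad_eq:
  assumes "GDERIV f x :> g"
  shows "grad f x = g"
proof -
  have "g' = g" if "GDERIV f x :> g'" for g'
  proof -
    have "(\<lambda>h. h \<bullet> g') = (\<lambda>h. h \<bullet> g)"
      using that assms unfolding gderiv_def by (rule has_derivative_unique)
    then show ?thesis by (metis vector_eq_ldot)
  qed
  with assms show ?thesis unfolding grad_def by (intro the_equality)
qed

lemma differentiable_GDERIV_grad:
  fixes f :: "'a::euclidean_space \<Rightarrow> real"
  assumes "f differentiable (at x)"
  shows "GDERIV f x :> grad f x"
proof -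
  obtain D where D: "(f has_derivative D) (at x)"
    using assms unfolding differentiable_def by blast
  have lin: "linear D" using D has_derivative_linear by blast
  define g where "g = (\<Sum>b\<in>Basis. D b *\<^sub>R b)"
  have "D h = h \<bullet> g" for h
  proof -
    have "D h = D (\<Sum>b\<in>Basis. (h \<bullet> b) *\<^sub>R b)" by (simp add: euclidean_representation)
    also have "\<dots> = (\<Sum>b\<in>Basis. (h \<bullet> b) * D b)"
      by (simp add: linear_sum[OF lin] linear_scale[OF lin])
    also have "\<dots> = h \<bullet> g" by (simp add: g_def inner_sum_right mult.commute)
    finally show ?thesis .
  qed
  then have "D = (\<lambda>h. h \<bullet> g)" by blast
  with D have "GDERIV f x :> g" by (simp add: gderiv_def)
  with GDERIV_grad_eq show ?thesis by metis
qed

lemma descent_lemma: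
  fixes \<phi> :: "'a::euclidean_space \<Rightarrow> real"
  assumes diff: "\<And>x. \<phi> differentiable (at x)"
    and lip: "L-lipschitz_on UNIV (grad \<phi>)"
  shows "\<phi> y \<le> \<phi> x + grad \<phi> x \<bullet> (y - x) + L / 2 * (norm (y - x))\<^sup>2"
proof -
  define d where "d = y - x"
  define h where "h t = \<phi> (x + t *\<^sub>R d) - t * (grad \<phi> x \<bullet> d) - L / 2 * t\<^sup>2 * (norm d)\<^sup>2" for t :: real
  \<comment> \<open>The gap \<open>h\<close> between \<open>\<phi>\<close> and its quadratic model does not increase along the segment
    from \<open>x\<close> to \<open>y\<close>, as the Lipschitz bound makes its derivative nonpositive.\<close>
  have "h 1 \<le> h 0"
  proof (rule DERIV_nonpos_imp_nonincreasing[of 0 1 h])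
    fix t :: real
    assume t: "0 \<le> t" "t \<le> 1"
    let ?D = "d \<bullet> grad \<phi> (x + t *\<^sub>R d) - grad \<phi> x \<bullet> d - L * t * (norm d)\<^sup>2"
    have "(\<phi> has_derivative (\<lambda>h. h \<bullet> grad \<phi> (x + t *\<^sub>R d))) (at (x + t *\<^sub>R d))"
      using differentiable_GDERIV_grad[OF diff] unfolding gderiv_def by blast
    moreover have "((\<lambda>t. x + t *\<^sub>R d) has_derivative (\<lambda>s. s *\<^sub>R d)) (at t)"
      by (auto intro!: derivative_eq_intros)
    ultimately have "((\<lambda>t. \<phi> (x + t *\<^sub>R d)) has_derivative
        (\<lambda>s. (s *\<^sub>R d) \<bullet> grad \<phi> (x + t *\<^sub>R d))) (at t)"
      using has_derivative_compose by blast
    then have "((\<lambda>t. \<phi> (x + t *\<^sub>R d)) has_real_derivative (d \<bullet> grad \<phi> (x + t *\<^sub>R d))) (at t)"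
      by (simp add: has_field_derivative_def mult.commute[of _ "d \<bullet> _"])
    then have der: "(h has_real_derivative ?D) (at t)"
      unfolding h_def by (auto intro!: derivative_eq_intros)
    have "norm (grad \<phi> (x + t *\<^sub>R d) - grad \<phi> x) \<le> L * norm (t *\<^sub>R d)"
      using lipschitz_onD[OF lip, of "x + t *\<^sub>R d" x] by (simp add: dist_norm)
    then have "norm (grad \<phi> (x + t *\<^sub>R d) - grad \<phi> x) * norm d \<le> L * t * norm d * norm d"
      using t by (intro mult_right_mono) (auto simp: mult.assoc)
    moreover have "(grad \<phi> (x + t *\<^sub>R d) - grad \<phi> x) \<bullet> d
        \<le> norm (grad \<phi> (x + t *\<^sub>R d) - grad \<phi> x) * norm d"
      by (rule norm_cauchy_schwarz)
    ultimately have "?D \<le> 0"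
      by (simp add: inner_diff_left inner_commute[of d] power2_eq_square)
    with der show "\<exists>y. (h has_real_derivative y) (at t) \<and> y \<le> 0" by blast
  qed simp
  then show ?thesis by (simp add: h_def d_def)
qed

lemma GDERIV_batch_mean:
  assumes "\<And>i. i \<in> S \<Longrightarrow> f i differentiable (at x)"
  shows "GDERIV (batch_mean f S) x :> (1 / real (card S)) *\<^sub>R (\<Sum>i\<in>S. grad (f i) x)"
proof -
  have "((\<lambda>x. (1 / real (card S)) * (\<Sum>i\<in>S. f i x)) has_derivative
      (\<lambda>h. (1 / real (card S)) * (\<Sum>i\<in>S. h \<bullet> grad (f i) x))) (at x)"
    using differentiable_GDERIV_grad[OF assms]
    by (intro has_derivative_mult_right has_derivative_sum) (auto simp: gderiv_def)
  moreover have "(\<lambda>h. (1 / real (card S)) * (\<Sum>i\<in>S. h \<bullet> grad (f i) x))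
      = (\<lambda>h. h \<bullet> ((1 / real (card S)) *\<^sub>R (\<Sum>i\<in>S. grad (f i) x)))"
    by (simp add: inner_sum_right)
  moreover have "batch_mean f S = (\<lambda>x. (1 / real (card S)) * (\<Sum>i\<in>S. f i x))"
    by (simp add: fun_eq_iff batch_mean_def)
  ultimately show ?thesis by (simp add: gderiv_def)
qed

lemma batch_mean_differentiable:
  assumes "\<And>i. i \<in> S \<Longrightarrow> f i differentiable (at x)"
  shows "batch_mean f S differentiable (at x)"
  using GDERIV_batch_mean[OF assms, of S] unfolding gderiv_def by (rule differentiableI)

lemma batch_mean_lipschitz_grad:
  assumes diff: "\<And>i x. i \<in> S \<Longrightarrow> f i differentiable (at x)"
    and lip: "\<And>i. i \<in> S \<Longrightarrow> L-lipschitz_on UNIV (grad (f i))"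
    and S: "finite S" "S \<noteq> {}"
  shows "L-lipschitz_on UNIV (grad (batch_mean f S))"
proof (rule lipschitz_onI)
  obtain i where "i \<in> S" using S by blast
  with lip show "0 \<le> L" using lipschitz_on_nonneg by blast
next
  fix x y
  have c: "0 < real (card S)" using S by (simp add: card_gt_0_iff)
  have "norm (\<Sum>i\<in>S. grad (f i) x - grad (f i) y) \<le> (\<Sum>i\<in>S. L * dist x y)"
    using lipschitz_onD[OF lip, of _ x y] by (intro sum_norm_le) (auto simp: dist_norm)
  then have "norm (\<Sum>i\<in>S. grad (f i) x - grad (f i) y) \<le> real (card S) * (L * dist x y)" by simp
  moreover have "grad (batch_mean f S) x - grad (batch_mean f S) y
      = (1 / real (card S)) *\<^sub>R (\<Sum>i\<in>S. grad (f i) x - grad (f i) y)"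
    using GDERIV_grad_eq[OF GDERIV_batch_mean[OF diff]]
    by (simp add: scaleR_diff_right sum_subtractf)
  ultimately show "dist (grad (batch_mean f S) x) (grad (batch_mean f S) y) \<le> L * dist x y"
    unfolding dist_norm[of "grad _ _"] using c by (simp add: divide_le_eq mult.commute)
qed

section \<open>The proximal map of a finite convex function\<close>

text \<open>
  The value of \<open>arg_min\<close> has the minimising property only once some minimiser is known to exist.
  Existence follows from compactness of a ball outside which the objective exceeds its value at
  the centre \<open>x\<close>.
\<close>

lemma prox_le:
  fixes R :: "'a::euclidean_space \<Rightarrow> real"
  assumes R: "convex_on UNIV R" and a: "0 \<le> a"
  shows "a * R (prox a R x) + 1/2 * (norm (prox a R x - x))\<^sup>2 \<le> a * R y + 1/2 * (norm (y - x))\<^sup>2"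
proof -
  define h where "h y = a * R y + 1/2 * (norm (y - x))\<^sup>2" for y
  have Rcont: "continuous_on S R" for S
    using convex_on_continuous[OF open_UNIV R] continuous_on_subset by blast
  have "\<exists>q\<in>cball x 1. \<forall>u\<in>cball x 1. R q \<le> R u"
    by (intro continuous_attains_inf) (auto simp: Rcont)
  then obtain q where "\<And>u. u \<in> cball x 1 \<Longrightarrow> R q \<le> R u" by blast
  then obtain m where m: "\<And>u. norm (u - x) \<le> 1 \<Longrightarrow> m \<le> R u"
    by (metis mem_cball dist_norm norm_minus_commute)
  define \<rho> where "\<rho> = max 1 (2 * a * (R x - m))"
  \<comment> \<open>Along the ray from \<open>x\<close> through \<open>y\<close>, convexity propagates the lower bound \<open>m\<close> on the
    unit ball to a lower bound that is affine in the distance \<open>r\<close>; the term \<open>r\<^sup>2 / 2\<close> wins.\<close>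
  have far: "h x \<le> h y" if y: "\<rho> < norm (y - x)" for y
  proof -
    define r where "r = norm (y - x)"
    have r: "1 < r" "2 * a * (R x - m) < r" using y by (auto simp: r_def \<rho>_def)
    have eq: "x + (1/r) *\<^sub>R (y - x) = (1 - 1/r) *\<^sub>R x + (1/r) *\<^sub>R y"
      by (simp add: algebra_simps)
    have "m \<le> R (x + (1/r) *\<^sub>R (y - x))"
      using r by (intro m) (simp add: r_def[symmetric])
    also have "\<dots> \<le> (1 - 1/r) * R x + (1/r) * R y"
      unfolding eq using r by (intro convex_onD[OF R]) auto
    finally have "r * m \<le> r * ((1 - 1/r) * R x + (1/r) * R y)"
      using r by (intro mult_left_mono) auto
    also have "\<dots> = r * R x - R x + R y" using r by (simp add: field_simps)
    finally have "a * (R x - r * (R x - m)) \<le> a * R y"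
      using a by (intro mult_left_mono) (auto simp: algebra_simps)
    moreover have "r * (2 * a * (R x - m)) \<le> r * r" using r by (intro mult_left_mono) auto
    ultimately show ?thesis
      by (simp add: h_def r_def[symmetric] power2_eq_square algebra_simps)
  qed
  have \<rho>: "0 \<le> \<rho>" by (simp add: \<rho>_def)
  have "\<exists>p\<in>cball x \<rho>. \<forall>u\<in>cball x \<rho>. h p \<le> h u"
    unfolding h_def
    by (intro continuous_attains_inf) (auto intro!: continuous_intros Rcont simp: \<rho>_def)
  then obtain p where p: "\<And>u. norm (u - x) \<le> \<rho> \<Longrightarrow> h p \<le> h u"
    by (metis mem_cball dist_norm norm_minus_commute)
  have "h p \<le> h u" for u
    using p[of u] p[of x] far[of u] \<rho> by (cases "norm (u - x) \<le> \<rho>") auto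
  then have "h (arg_min h (\<lambda>_. True)) \<le> h y"
    using arg_min_equality[of "\<lambda>_. True" p h] by simp
  moreover have "prox a R x = arg_min h (\<lambda>_. True)" unfolding prox_def h_def ..
  ultimately show ?thesis by (simp add: h_def)
qed

text \<open>
  Fermat's rule for the proximal problem: compare \<open>p = prox a R x\<close> with the points
  \<open>(1 - t) p + t y\<close>, use convexity of \<open>R\<close>, divide by \<open>t\<close> and let \<open>t\<close> tend to \<open>0\<close>.
\<close>

lemma prox_subgradient:
  fixes R :: "'a::euclidean_space \<Rightarrow> real"
  assumes R: "convex_on UNIV R" and a: "0 < a"
  shows "(1 / a) *\<^sub>R (x - prox a R x) \<in> subdifferential R (prox a R x)"
proof -
  define p where "p = prox a R x"
  have "0 \<le> a * (R y - R p) + (p - x) \<bullet> (y - p)" (is "0 \<le> ?A") for y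
  proof -
    have bound: "0 \<le> ?A + t * (1/2 * (norm (y - p))\<^sup>2)" if t: "0 < t" "t < 1" for t
    proof -
      define z where "z = (1 - t) *\<^sub>R p + t *\<^sub>R y"
      have z: "z - x = (p - x) + t *\<^sub>R (y - p)" by (simp add: z_def algebra_simps)
      have n: "(norm (z - x))\<^sup>2
          = (norm (p - x))\<^sup>2 + 2 * t * ((p - x) \<bullet> (y - p)) + t\<^sup>2 * (norm (y - p))\<^sup>2"
        unfolding z power2_norm_eq_inner inner_add_left inner_add_right
        by (simp add: inner_commute[of "y - p" "p - x"] power2_eq_square)
      have "R z \<le> (1 - t) * R p + t * R y"
        unfolding z_def using t by (intro convex_onD[OF R]) auto
      then have "a * R z \<le> a * ((1 - t) * R p + t * R y)"
        using a by (intro mult_left_mono) auto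
      moreover have "a * R p + 1/2 * (norm (p - x))\<^sup>2 \<le> a * R z + 1/2 * (norm (z - x))\<^sup>2"
        unfolding p_def by (rule prox_le) (use R a in auto)
      ultimately have "0 \<le> t * (?A + t * (1/2 * (norm (y - p))\<^sup>2))"
        unfolding n by (simp add: algebra_simps power2_eq_square)
      with t show ?thesis by (simp add: zero_le_mult_iff)
    qed
    have "((\<lambda>t. ?A + t * (1/2 * (norm (y - p))\<^sup>2)) \<longlongrightarrow> ?A + 0 * (1/2 * (norm (y - p))\<^sup>2)) (at_right 0)"
      by (intro tendsto_intros)
    moreover have "\<forall>\<^sub>F t in at_right 0. 0 \<le> ?A + t * (1/2 * (norm (y - p))\<^sup>2)"
      using bound by (auto simp: eventually_at_right[of 0 1] intro!: exI[of _ 1])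
    ultimately have "0 \<le> ?A + 0 * (1/2 * (norm (y - p))\<^sup>2)"
      by (intro tendsto_lowerbound) auto
    then show ?thesis by simp
  qed
  moreover have "(p - x) \<bullet> v = - ((x - p) \<bullet> v)" for v
    by (simp add: inner_diff_left)
  ultimately have "(x - p) \<bullet> (y - p) \<le> (R y - R p) * a" for y
    by (simp add: mult.commute)
  then have "(x - p) \<bullet> (y - p) / a \<le> R y - R p" for y
    using a by (simp add: pos_divide_le_eq)
  then have "R p + ((1 / a) *\<^sub>R (x - p)) \<bullet> (y - p) \<le> R y" for y
    by (simp add: add.commute le_diff_eq)
  then show ?thesis by (simp add: subdifferential_def p_def)
qed

text \<open>
  A finite convex function on a Euclidean space is continuous, so the subgradient inequality
  survives limits in both the point and the subgradient.
\<close>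

lemma subdifferential_limit:
  fixes R :: "'a::euclidean_space \<Rightarrow> real"
  assumes R: "convex_on UNIV R"
    and y: "y \<longlonglongrightarrow> z" and v: "v \<longlonglongrightarrow> w"
    and sub: "\<And>n. v n \<in> subdifferential R (y n)"
  shows "w \<in> subdifferential R z"
proof -
  have "isCont R z"
    using convex_on_continuous[OF open_UNIV R] by (simp add: continuous_on_eq_continuous_at)
  then have Ry: "(\<lambda>n. R (y n)) \<longlonglongrightarrow> R z" using y by (rule isCont_tendsto_compose)
  have "R z + w \<bullet> (u - z) \<le> R u" for u
  proof (rule LIMSEQ_le_const2)
    show "(\<lambda>n. R (y n) + v n \<bullet> (u - y n)) \<longlonglongrightarrow> R z + w \<bullet> (u - z)"
      by (intro tendsto_intros Ry y v)
    show "\<exists>n0. \<forall>n\<ge>n0. R (y n) + v n \<bullet> (u - y n) \<le> R u"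
      using sub by (auto simp: subdifferential_def)
  qed
  then show ?thesis by (simp add: subdifferential_def)
qed

section \<open>Proximal gradient iterations with inexact gradients\<close>

text \<open>
  The descent lemma, used at the exact gradient, and the subgradient inequality, used at the inexact
  one, combine, for \<open>d = y - x\<close> and \<open>e = grad \<phi> x - g\<close>, to a decrease of \<open>(1 / a - L / 2) * (norm d)\<^sup>2\<close> with an error \<open>e \<bullet> d\<close>.
  Young's inequality spends \<open>1 / (2 * a)\<close> of that coefficient on the error, and
  \<open>a \<le> 1 / (2 * L)\<close> keeps what is left at least \<open>L / 2\<close>.
\<close>

lemma inexact_prox_gradient_decrease:
  fixes \<phi> R :: "'a::euclidean_space \<Rightarrow> real"
  assumes diff: "\<And>x. \<phi> differentiable (at x)"
    and lip: "L-lipschitz_on UNIV (grad \<phi>)"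
    and R: "convex_on UNIV R"
    and L: "0 < L" and a: "0 < a" "a \<le> 1 / (2 * L)"
    and y: "y = prox a R (x - a *\<^sub>R g)"
  shows "\<phi> y + R y + L / 2 * (norm (y - x))\<^sup>2 \<le> \<phi> x + R x + a / 2 * (norm (grad \<phi> x - g))\<^sup>2"
proof -
  define d e where "d = y - x" and "e = grad \<phi> x - g"
  have "(1 / a) *\<^sub>R (x - a *\<^sub>R g - y) \<in> subdifferential R y"
    unfolding y by (rule prox_subgradient[OF R a(1)])
  then have "R y + ((1 / a) *\<^sub>R (x - a *\<^sub>R g - y)) \<bullet> (x - y) \<le> R x"
    by (simp add: subdifferential_def)
  moreover have "((1 / a) *\<^sub>R (x - a *\<^sub>R g - y)) \<bullet> (x - y) = (norm d)\<^sup>2 / a + g \<bullet> d"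
  proof -
    have "(1 / a) *\<^sub>R (x - a *\<^sub>R g - y) = - ((1 / a) *\<^sub>R d) - g"
      using a by (simp add: d_def algebra_simps)
    moreover have "x - y = - d" by (simp add: d_def)
    ultimately show ?thesis
      by (simp add: inner_diff_left power2_norm_eq_inner)
  qed
  ultimately have Ry: "R y + (norm d)\<^sup>2 / a + g \<bullet> d \<le> R x" by simp
  have \<phi>y: "\<phi> y \<le> \<phi> x + grad \<phi> x \<bullet> d + L / 2 * (norm d)\<^sup>2"
    unfolding d_def by (rule descent_lemma[OF diff lip])
  have "0 \<le> (norm (a *\<^sub>R e - d))\<^sup>2" by simp
  also have "\<dots> = a\<^sup>2 * (norm e)\<^sup>2 - 2 * a * (e \<bullet> d) + (norm d)\<^sup>2"
    unfolding power2_norm_eq_inner inner_diff_left inner_diff_right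
    by (simp add: inner_commute[of d e] power2_eq_square)
  finally have young: "e \<bullet> d \<le> a / 2 * (norm e)\<^sup>2 + (norm d)\<^sup>2 / (2 * a)"
    using a by (simp add: field_simps power2_eq_square)
  have "L \<le> 1 / (2 * a)" using a L by (simp add: field_simps)
  then have "L * (norm d)\<^sup>2 \<le> 1 / (2 * a) * (norm d)\<^sup>2" by (rule mult_right_mono) simp
  moreover have "(norm d)\<^sup>2 / a = 2 * ((norm d)\<^sup>2 / (2 * a))" using a by simp
  ultimately show ?thesis
    using Ry \<phi>y young unfolding e_def[symmetric] d_def[symmetric]
    by (simp add: e_def inner_diff_left)
qed

lemma inexact_prox_gradient_limit_stationary:
  fixes \<phi> R :: "'a::euclidean_space \<Rightarrow> real"
  assumes diff: "\<And>x. \<phi> differentiable (at x)"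
    and lip: "L-lipschitz_on UNIV (grad \<phi>)"
    and R: "convex_on UNIV R"
    and bdd: "\<And>x. Finf \<le> \<phi> x + R x"
    and L: "0 < L" and a: "0 < a" "a \<le> 1 / (2 * L)"
    and step: "\<And>k. x (Suc k) = prox a R (x k - a *\<^sub>R g k)"
    and err: "summable (\<lambda>k. (norm (grad \<phi> (x k) - g k))\<^sup>2)"
    and r: "strict_mono r" "(\<lambda>j. x (r j)) \<longlonglongrightarrow> z"
  shows "stationary_point \<phi> R z"
proof -
  define d e where "d k = x (Suc k) - x k" and "e k = grad \<phi> (x k) - g k" for k
  have err': "summable (\<lambda>k. (norm (e k))\<^sup>2)" using err by (simp add: e_def)
  have decrease: "\<phi> (x (Suc k)) + R (x (Suc k)) + L / 2 * (norm (d k))\<^sup>2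
      \<le> \<phi> (x k) + R (x k) + a / 2 * (norm (e k))\<^sup>2" for k
    unfolding d_def e_def by (rule inexact_prox_gradient_decrease[OF diff lip R L a step])
  have telescoped: "\<phi> (x n) + R (x n) + L / 2 * (\<Sum>k<n. (norm (d k))\<^sup>2)
      \<le> \<phi> (x 0) + R (x 0) + a / 2 * (\<Sum>k<n. (norm (e k))\<^sup>2)" for n
  proof (induction n)
    case (Suc n)
    then show ?case using decrease[of n] by (simp add: distrib_left)
  qed simp
  have "summable (\<lambda>k. (norm (d k))\<^sup>2)"
  proof (rule summableI_nonneg_bounded)
    fix n
    have "(\<Sum>k<n. (norm (e k))\<^sup>2) \<le> (\<Sum>k. (norm (e k))\<^sup>2)"
      by (intro sum_le_suminf err') auto
    then have "a / 2 * (\<Sum>k<n. (norm (e k))\<^sup>2) \<le> a / 2 * (\<Sum>k. (norm (e k))\<^sup>2)"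
      using a by (intro mult_left_mono) auto
    then have "L / 2 * (\<Sum>k<n. (norm (d k))\<^sup>2)
        \<le> \<phi> (x 0) + R (x 0) + a / 2 * (\<Sum>k. (norm (e k))\<^sup>2) - Finf"
      using telescoped[of n] bdd[of "x n"] by linarith
    then show "(\<Sum>k<n. (norm (d k))\<^sup>2)
        \<le> (\<phi> (x 0) + R (x 0) + a / 2 * (\<Sum>k. (norm (e k))\<^sup>2) - Finf) / (L / 2)"
      using L by (simp add: pos_le_divide_eq mult.commute)
  qed simp
  then have "d \<longlonglongrightarrow> 0" "e \<longlonglongrightarrow> 0"
    using err'[THEN summable_LIMSEQ_zero]
    by (auto dest!: summable_LIMSEQ_zero simp: power_tendsto_0_iff tendsto_norm_zero_iff)
  then have d: "(\<lambda>j. d (r j)) \<longlonglongrightarrow> 0" and e: "(\<lambda>j. e (r j)) \<longlonglongrightarrow> 0"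
    using LIMSEQ_subseq_LIMSEQ[OF _ r(1)] by (auto simp: comp_def)
  have "(\<lambda>j. x (r j) + d (r j)) \<longlonglongrightarrow> z + 0" by (intro tendsto_add r d)
  then have y: "(\<lambda>j. x (Suc (r j))) \<longlonglongrightarrow> z" by (simp add: d_def)
  have "isCont (grad \<phi>) z"
    using lipschitz_on_continuous_on[OF lip] by (simp add: continuous_on_eq_continuous_at)
  then have grad: "(\<lambda>j. grad \<phi> (x (r j))) \<longlonglongrightarrow> grad \<phi> z"
    using r(2) by (rule isCont_tendsto_compose)
  have "(1 / a) *\<^sub>R (x k - a *\<^sub>R g k - x (Suc k)) \<in> subdifferential R (x (Suc k))" for k
    unfolding step by (rule prox_subgradient[OF R a(1)])
  moreover have "(1 / a) *\<^sub>R (x k - a *\<^sub>R g k - x (Suc k))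
      = e k - grad \<phi> (x k) - (1 / a) *\<^sub>R d k" for k
    using a by (simp add: d_def e_def algebra_simps)
  ultimately have sub: "e (r j) - grad \<phi> (x (r j)) - (1 / a) *\<^sub>R d (r j)
      \<in> subdifferential R (x (Suc (r j)))" for j by simp
  have "(\<lambda>j. e (r j) - grad \<phi> (x (r j)) - (1 / a) *\<^sub>R d (r j))
      \<longlonglongrightarrow> 0 - grad \<phi> z - (1 / a) *\<^sub>R 0"
    by (intro tendsto_intros e d grad)
  then have "0 - grad \<phi> z - (1 / a) *\<^sub>R 0 \<in> subdifferential R z"
    using subdifferential_limit[OF R y _ sub] by blast
  then show ?thesis
    unfolding stationary_point_def by (auto intro!: image_eqI[of _ _ "- grad \<phi> z"])
qed

section \<open>The line search and the schedule\<close>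

text \<open>
  For \<open>a0 \<le> 1 / L\<close> the line-search inequality is implied by the descent lemma, whatever the
  trial point is.
\<close>

lemma backtracking_accepts_initial:
  fixes \<phi> R :: "'a::euclidean_space \<Rightarrow> real"
  assumes diff: "\<And>x. \<phi> differentiable (at x)"
    and lip: "L-lipschitz_on UNIV (grad \<phi>)"
    and L: "0 < L" and a0: "0 < a0" "a0 \<le> 1 / L"
    and bt: "backtracking_steplength \<phi> R a0 \<beta> x a"
  shows "a = a0"
proof -
  have "linesearch_ok \<phi> R x a0"
  proof -
    define y where "y = prox a0 R (x - a0 *\<^sub>R grad \<phi> x)"
    have "L / 2 \<le> 1 / (2 * a0)" using a0 L by (simp add: field_simps)
    then have "L / 2 * (norm (y - x))\<^sup>2 \<le> 1 / (2 * a0) * (norm (y - x))\<^sup>2"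
      by (rule mult_right_mono) simp
    with descent_lemma[OF diff lip, of y x] show ?thesis
      unfolding linesearch_ok_def Let_def y_def[symmetric] by linarith
  qed
  with bt show ?thesis
    unfolding backtracking_steplength_def by (metis mult_1 power_0 gr0I)
qed

text \<open>
  Mini-batches are never empty, so every epoch performs at least one iteration; hence the counter
  is unbounded and each iteration \<open>k\<close> belongs to some epoch.
\<close>

lemma fb_lisa_schedule_epoch:
  assumes sched: "fb_lisa_schedule N nmax N0 C \<epsilon> kh Nt"
    and pos: "0 < N" "0 < nmax" "0 < N0"
  obtains t where "1 \<le> t" "kh t \<le> k" "k < kh (t + 1)" "0 < Nt t"
proof -
  have Nt: "0 < Nt t" if "1 \<le> t" for t
    using sched that pos unfolding fb_lisa_schedule_def by simp
  have "kh t < kh (t + 1)" if "1 \<le> t" for t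
    using sched that Nt[OF that] pos unfolding fb_lisa_schedule_def by simp
  then have mono: "t \<le> kh (t + 1)" for t
    by (induction t) (auto simp: Suc_le_eq dest: le_less_trans)
  have "kh 1 = 0" using sched unfolding fb_lisa_schedule_def by simp
  \<comment> \<open>The first epoch that ends after iteration \<open>k\<close>; it is not epoch \<open>0\<close> because
    \<open>kh 1 = 0\<close>.\<close>
  define t where "t = (LEAST t. k < kh (t + 1))"
  have ex: "k < kh (Suc k + 1)" using mono[of "Suc k"] by simp
  have least: "k < kh (t + 1)" unfolding t_def using ex by (rule LeastI)
  have "t \<noteq> 0"
  proof
    assume "t = 0"
    with least \<open>kh 1 = 0\<close> show False by simp
  qed
  moreover from this have "\<not> k < kh (t - 1 + 1)"
    unfolding t_def by (intro not_less_Least) (simp add: t_def[symmetric])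
  ultimately show thesis using that[of t] least Nt[of t] by simp
qed

section \<open>Measurability and integrability along the process\<close>

lemma subalgebra_history:
  assumes "\<And>i. i \<le> k \<Longrightarrow> X i \<in> borel_measurable M"
  shows "subalgebra M (history M X k)"
proof -
  let ?G = "\<Union>i\<in>{..k}. {X i -` A \<inter> space M | A. A \<in> sets borel}"
  have G: "?G \<subseteq> sets M" using assms by (auto intro: measurable_sets)
  then have "?G \<subseteq> Pow (space M)" using sets.space_closed by blast
  then show ?thesis
    using sets.sigma_sets_subset[OF G] by (simp add: subalgebra_def history_def)
qed

lemma AE_summable_of_summable_expectation:
  fixes Z :: "nat \<Rightarrow> 'w \<Rightarrow> real"
  assumes int: "\<And>k. integrable M (Z k)" and nonneg: "\<And>k \<omega>. 0 \<le> Z k \<omega>"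
    and le: "\<And>k. (\<integral>\<omega>. Z k \<omega> \<partial>M) \<le> \<epsilon> k" and \<epsilon>: "summable \<epsilon>"
  shows "AE \<omega> in M. summable (\<lambda>k. Z k \<omega>)"
proof -
  have \<epsilon>0: "0 \<le> \<epsilon> k" for k
    using le[of k] Bochner_Integration.integral_nonneg[of M "Z k"] nonneg by fastforce
  have [measurable]: "Z k \<in> borel_measurable M" for k using int by auto
  have "(\<integral>\<^sup>+\<omega>. (\<Sum>k. ennreal (Z k \<omega>)) \<partial>M) = (\<Sum>k. \<integral>\<^sup>+\<omega>. ennreal (Z k \<omega>) \<partial>M)"
    by (intro nn_integral_suminf) simp
  also have "\<dots> \<le> (\<Sum>k. ennreal (\<epsilon> k))"
    using le by (intro suminf_le) (auto simp: nn_integral_eq_integral[OF int] nonneg ennreal_leI)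
  also have "\<dots> < \<infinity>" using suminf_ennreal2[OF \<epsilon>0 \<epsilon>] by simp
  finally have "AE \<omega> in M. (\<Sum>k. ennreal (Z k \<omega>)) \<noteq> \<infinity>"
    by (intro nn_integral_noteq_infinite) auto
  then show ?thesis
    by (rule AE_mp) (auto intro!: AE_I2 summable_suminf_not_top nonneg)
qed

lemma (in finite_measure) integrable_real_simple_function:
  fixes h :: "'a \<Rightarrow> real"
  assumes "simple_function M h"
  shows "integrable M h"
proof (rule integrable_const_bound)
  show "h \<in> borel_measurable M" using assms by (rule borel_measurable_simple_function)
  show "AE \<omega> in M. norm (h \<omega>) \<le> Max (norm ` h ` space M)"
    using simple_functionD(1)[OF assms] by (intro AE_I2 Max_ge) auto
qed

lemma simple_function_count_space:
  assumes "B \<in> M \<rightarrow>\<^sub>M count_space A" "finite A"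
  shows "simple_function M B"
  unfolding simple_function_def
proof safe
  have sub: "B ` space M \<subseteq> A" using measurable_space[OF assms(1)] by auto
  then show "finite (B ` space M)" using assms(2) finite_subset by blast
  fix \<omega> assume "\<omega> \<in> space M"
  with sub show "B -` {B \<omega>} \<inter> space M \<in> sets M"
    by (intro measurable_sets[OF assms(1)]) auto
qed

text \<open>
  A deterministic start and finitely valued noise keep every iterate finitely valued. Every
  preimage is then a finite union of events fixing the previous iterate and the noise, so \<open>h\<close>
  can be arbitrary; this makes the lemma applicable to a step built from the proximal map and
  gradients.
\<close>

lemma simple_function_recursion:
  assumes "\<And>\<omega>. \<omega> \<in> space M \<Longrightarrow> X 0 \<omega> = x0"
    and "\<And>k. simple_function M (B k)"
    and "\<And>k \<omega>. \<omega> \<in> space M \<Longrightarrow> X (Suc k) \<omega> = h (X k \<omega>) (B k \<omega>)"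
  shows "simple_function M (X k)"
proof (induction k)
  case 0
  have "simple_function M (X 0) \<longleftrightarrow> simple_function M (\<lambda>\<omega>. x0)"
    using assms(1) by (intro simple_function_cong) auto
  then show ?case by simp
next
  case (Suc k)
  have "simple_function M (X (Suc k)) \<longleftrightarrow> simple_function M (\<lambda>\<omega>. h (X k \<omega>) (B k \<omega>))"
    using assms(3) by (rule simple_function_cong)
  with simple_function_compose2[OF Suc assms(2)] show ?case by simp
qed

section \<open>Almost sure stationarity of the limit points\<close>

theorem theorem1:
  fixes f :: "nat \<Rightarrow> real ^ 'd \<Rightarrow> real"
    and R :: "real ^ 'd \<Rightarrow> real"
    and N nmax N0 :: nat
    and L Finf \<alpha>0 \<alpha>max \<beta> C :: real
    and \<epsilon> :: "nat \<Rightarrow> real"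
    and M :: "'w measure"
    and x0 :: "real ^ 'd"
    and B :: "nat \<Rightarrow> 'w \<Rightarrow> nat set"
    and X :: "nat \<Rightarrow> 'w \<Rightarrow> real ^ 'd"
  assumes L_pos: "0 < L"
    and f_diff: "\<And>i x. i \<in> {1..N} \<Longrightarrow> f i differentiable (at x)"
    and f_lip: "\<And>i. i \<in> {1..N} \<Longrightarrow> L-lipschitz_on UNIV (grad (f i))"
    and R_convex: "convex_on UNIV R"
    and F_bdd: "\<And>x. Finf \<le> batch_mean f {1..N} x + R x"
    and nmax: "0 < nmax" "nmax \<le> N"
    and N0: "0 < N0" "N0 < N"
    and alpha0: "0 < \<alpha>0" "\<alpha>0 \<le> \<alpha>max"
    and alphamax: "0 < \<alpha>max" "\<alpha>max \<le> 1 / (2 * L)"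
    and beta: "0 < \<beta>" "\<beta> < 1"
    and C_pos: "0 < C"
    and eps: "\<And>k. 0 < \<epsilon> k" "summable \<epsilon>"
    and M: "prob_space M"
    and process: "fb_lisa_process M f R N nmax N0 \<alpha>0 \<beta> C \<epsilon> x0 B X"
    and variance: "\<And>k. AE \<omega> in M.
      real_cond_exp M (history M X k)
        (\<lambda>\<omega>. (norm (grad (batch_mean f {1..N}) (X k \<omega>)
                   - grad (batch_mean f (B k \<omega>)) (X k \<omega>)))\<^sup>2) \<omega> \<le> \<epsilon> k"
  shows "AE \<omega> in M. \<forall>z.
    (\<exists>r. strict_mono r \<and> (\<lambda>j. X (r j) \<omega>) \<longlonglongrightarrow> z) \<longrightarrow>
    stationary_point (batch_mean f {1..N}) R z"
proof -
  interpret prob_space M by (rule M)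
  define \<phi> where "\<phi> = batch_mean f {1..N}"
  define G where "G x S = grad (batch_mean f S) x" for x S
  obtain kh Nt where sched: "fb_lisa_schedule N nmax N0 C \<epsilon> kh Nt"
    and unif: "\<And>t k. 1 \<le> t \<Longrightarrow> kh t \<le> k \<Longrightarrow> k < kh (t + 1)
      \<Longrightarrow> uniform_minibatch M (history M X k) N (Nt t) (B k)"
    and X0: "\<And>\<omega>. \<omega> \<in> space M \<Longrightarrow> X 0 \<omega> = x0"
    and step: "\<And>k \<omega>. \<omega> \<in> space M
      \<Longrightarrow> fb_lisa_step (batch_mean f (B k \<omega>)) R \<alpha>0 \<beta> (X k \<omega>) (X (Suc k) \<omega>)"
    using process unfolding fb_lisa_process_def by blast
  have batch: "\<exists>n>0. B k \<in> M \<rightarrow>\<^sub>M count_space (minibatches N n)" for k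
  proof -
    obtain t where t: "1 \<le> t" "kh t \<le> k" "k < kh (t + 1)" "0 < Nt t"
      using fb_lisa_schedule_epoch[OF sched, of k] N0 nmax by auto
    with unif show ?thesis unfolding uniform_minibatch_def by blast
  qed
  have fin: "finite (minibatches N n)" for n
    by (rule finite_subset[of _ "Pow {1..N}"]) (auto simp: minibatches_def)
  have B_simple: "simple_function M (B k)" for k
    using batch[of k] simple_function_count_space[OF _ fin] by blast
  have B_sub: "B k \<omega> \<subseteq> {1..N}" "B k \<omega> \<noteq> {}" if \<omega>: "\<omega> \<in> space M" for k \<omega>
  proof -
    obtain n where "0 < n" "B k \<in> M \<rightarrow>\<^sub>M count_space (minibatches N n)"
      using batch by blast
    with measurable_space[OF _ \<omega>, of "B k"] show "B k \<omega> \<subseteq> {1..N}" "B k \<omega> \<noteq> {}"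
      by (fastforce simp: minibatches_def)+
  qed
  have smooth: "batch_mean f S differentiable (at x)"
      "L-lipschitz_on UNIV (grad (batch_mean f S))"
    if S: "S \<subseteq> {1..N}" "S \<noteq> {}" for S x
  proof -
    show "batch_mean f S differentiable (at x)"
      using S f_diff by (intro batch_mean_differentiable) auto
    show "L-lipschitz_on UNIV (grad (batch_mean f S))"
      using S f_diff f_lip finite_subset[OF S(1)] by (intro batch_mean_lipschitz_grad) auto
  qed
  have \<alpha>0: "\<alpha>0 \<le> 1 / (2 * L)" using alpha0 alphamax by linarith
  have "1 / (2 * L) \<le> 1 / L" using L_pos by (simp add: field_simps)
  with \<alpha>0 have \<alpha>0': "\<alpha>0 \<le> 1 / L" by linarith
  have X_step: "X (Suc k) \<omega> = prox \<alpha>0 R (X k \<omega> - \<alpha>0 *\<^sub>R G (X k \<omega>) (B k \<omega>))"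
    if \<omega>: "\<omega> \<in> space M" for k \<omega>
    using step[OF \<omega>, of k]
      backtracking_accepts_initial[OF smooth[OF B_sub[OF \<omega>]] L_pos alpha0(1) \<alpha>0']
    unfolding fb_lisa_step_def G_def by blast
  have X_simple: "simple_function M (X k)" for k
    by (rule simple_function_recursion[where X = X and B = B
          and h = "\<lambda>x S. prox \<alpha>0 R (x - \<alpha>0 *\<^sub>R G x S)"]) (fact X0 B_simple X_step)+
  define Z where "Z k \<omega> = (norm (grad \<phi> (X k \<omega>) - G (X k \<omega>) (B k \<omega>)))\<^sup>2" for k \<omega>
  have "simple_function M (Z k)" for k
    unfolding Z_def
    by (rule simple_function_compose2[OF X_simple B_simple,
          where h = "\<lambda>x S. (norm (grad \<phi> x - G x S))\<^sup>2"])
  then have Z_int: "integrable M (Z k)" for k by (rule integrable_real_simple_function)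
  have Z_le: "(\<integral>\<omega>. Z k \<omega> \<partial>M) \<le> \<epsilon> k" for k
  proof -
    have "subalgebra M (history M X k)"
      using X_simple by (intro subalgebra_history borel_measurable_simple_function)
    then interpret H: finite_measure_subalgebra M "history M X k" by unfold_locales
    have "(\<integral>\<omega>. Z k \<omega> \<partial>M) = (\<integral>\<omega>. real_cond_exp M (history M X k) (Z k) \<omega> \<partial>M)"
      by (rule H.real_cond_exp_int(2)[OF Z_int, symmetric])
    also have "\<dots> \<le> (\<integral>\<omega>. \<epsilon> k \<partial>M)"
      using variance[of k] unfolding Z_def \<phi>_def G_def
      by (intro integral_mono_AE H.real_cond_exp_int(1) Z_int[unfolded Z_def \<phi>_def G_def]) auto
    finally show ?thesis by (simp add: prob_space)
  qed
  have "AE \<omega> in M. summable (\<lambda>k. Z k \<omega>)"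
    using Z_int _ Z_le eps(2) by (rule AE_summable_of_summable_expectation) (simp add: Z_def)
  then show ?thesis
  proof (rule AE_mp, intro AE_I2 impI allI)
    fix \<omega> z
    assume \<omega>: "\<omega> \<in> space M" and Z: "summable (\<lambda>k. Z k \<omega>)"
      and "\<exists>r. strict_mono r \<and> (\<lambda>j. X (r j) \<omega>) \<longlonglongrightarrow> z"
    then obtain r where r: "strict_mono r" "(\<lambda>j. X (r j) \<omega>) \<longlonglongrightarrow> z" by blast
    have full: "{1..N} \<subseteq> {1..N}" "{1..N} \<noteq> {}" using N0 by auto
    show "stationary_point (batch_mean f {1..N}) R z"
      using inexact_prox_gradient_limit_stationary[OF smooth[OF full] R_convex F_bdd L_pos
          alpha0(1) \<alpha>0 X_step[OF \<omega>] Z[unfolded Z_def \<phi>_def] r] .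
  qed
qed

end
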